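(* Let $n\ge2$. Let $\mathcal{O}_2$ denote the gauge orbit of $C^\infty(S^1,SL(n,\mathbb{R}))$ at $\partial_x$, let $\tau_2$ be the orbit symplectic form on $\mathcal{O}_2$, and let $\mathfrak{k}_2:\mathcal{M}_n(S^1)\to\mathcal{O}_2$ be the map $\mathfrak{k}_2(\gamma)=\partial_x+g^{-1}g_x$, where $g$ is the central affine moving frame along $\gamma$. Then $\mathfrak{k}_2^*\tau_2=\hat w_2$.
   Context: $\mathcal{M}_n(S^1)$ is the set of smooth $\gamma:S^1\to\mathbb{R}^n\setminus\{0\}$ with $\det(\gamma,\gamma_x,\ldots,\gamma_x^{(n-1)})=1$; the central affine moving frame $g=(\gamma,\gamma_x,\ldots,\gamma_x^{(n-1)})$ satisfies $g^{-1}g_x=b+u$, $b=\sum_{i=1}^{n-1}e_{i+1,i}$, $u=\sum_{i=1}^{n-1}u_ie_{in}$ the central affine curvature. Tangent vectors $\delta\gamma$ at $\gamma$ are the smooth maps $S^1\to\mathbb{R}^n$ satisfying the linearization of $\det(\gamma,\ldots,\gamma_x^{(n-1)})=1$; put $\delta g=(\delta\gamma,(\delta\gamma)_x,\ldots,(\delta\gamma)_x^{(n-1)})$. Let $\langle\xi,\eta\rangle=\oint\mathrm{tr}(\xi(x)\eta(x))\,dx$ and $[\partial_x+A,B]=B_x+[A,B]$. The 2-form $\hat w_2$ on $\mathcal{M}_n(S^1)$ is $$(\hat w_2)_\gamma(\delta_1\gamma,\delta_2\gamma)=\langle[\partial_x+b+u,\,g^{-1}\delta_1g],\,g^{-1}\delta_2g\rangle.$$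 The dual of the central extension of $C^\infty(S^1,sl(n,\mathbb{R}))$ defined by the 2-cocycle $\rho(\xi,\eta)=\oint\mathrm{tr}(\xi_x\eta)\,dx$ is identified with $\mathbb{R}\partial_x+C^\infty(S^1,sl(n,\mathbb{R}))$, the co-Adjoint action being the gauge action $g\cdot(\partial_x+v)=\partial_x+gvg^{-1}-g_xg^{-1}$. The orbit symplectic form is $\tau_\ell(\tilde\xi(\ell),\tilde\eta(\ell))=\ell([\xi,\eta])$ with $\tilde\xi,\tilde\eta$ the infinitesimal vector fields; thus here $\tilde\xi(\partial_x+v)=-[\partial_x+v,\xi]$ and $(\tau_2)_{\partial_x+v}(\tilde\xi,\tilde\eta)=\langle v,[\xi,\eta]\rangle+\rho(\xi,\eta)=\langle[\partial_x+v,\xi],\eta\rangle$. *)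

theory Defs
  imports "HOL-Analysis.Analysis"
begin

text \<open>
  \<open>S\<^sup>1\<close> is \<open>\<real> / 2\<pi>\<int>\<close>; maps on \<open>S\<^sup>1\<close> are \<open>2\<pi>\<close>-periodic maps on the real line.
  The dimension \<open>n\<close> is \<open>CARD('n)\<close>; the linear order on \<open>'n\<close> only serves to number the indices.
\<close>

type_synonym 'n rvec = "(real, 'n) vec"
type_synonym 'n rmat = "((real, 'n) vec, 'n) vec"

definition vderiv :: "(real \<Rightarrow> 'a::real_normed_vector) \<Rightarrow> real \<Rightarrow> 'a" where
  "vderiv f x = vector_derivative f (at x)"

definition smooth_loops :: "(real \<Rightarrow> 'a::real_normed_vector) set" where
  "smooth_loops =
     {f. (\<forall>k x. (vderiv ^^ k) f differentiable (at x)) \<and> (\<forall>x. f (x + 2 * pi) = f x)}"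

definition SL_loops :: "(real \<Rightarrow> 'n::finite rmat) set" where
  "SL_loops = {h \<in> smooth_loops. \<forall>x. det (h x) = 1}"

definition sl_loops :: "(real \<Rightarrow> 'n::finite rmat) set" where
  "sl_loops = {\<xi> \<in> smooth_loops. \<forall>x. trace (\<xi> x) = 0}"

text \<open>Zero-based position: row or column \<open>k\<close> (counted from 1) is the index of position \<open>k - 1\<close>.\<close>

definition index_pos :: "'n::{finite,linorder} \<Rightarrow> nat" where
  "index_pos i = card {j. j < i}"

text \<open>The matrix with columns \<open>\<gamma>, \<gamma>\<^sub>x, \<dots>, \<gamma>\<^sub>x\<^bsup>(n-1)\<^esup>\<close>;
  it is also used for \<open>\<delta>g\<close>, with \<open>\<delta>\<gamma>\<close> in place of \<open>\<gamma>\<close>.\<close>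

definition frame :: "(real \<Rightarrow> 'n rvec) \<Rightarrow> real \<Rightarrow> 'n::{finite,linorder} rmat" where
  "frame \<gamma> x = (\<chi> i j. ((vderiv ^^ index_pos j) \<gamma> x) $ i)"

definition central_affine_curves :: "(real \<Rightarrow> 'n::{finite,linorder} rvec) set" where
  "central_affine_curves =
     {\<gamma> \<in> smooth_loops. (\<forall>x. \<gamma> x \<noteq> 0) \<and> (\<forall>x. det (frame \<gamma> x) = 1)}"

definition curve_tangents ::
    "(real \<Rightarrow> 'n::{finite,linorder} rvec) \<Rightarrow> (real \<Rightarrow> 'n rvec) set" where
  "curve_tangents \<gamma> =
     {\<delta> \<in> smooth_loops. \<forall>x.
        ((\<lambda>t. det (frame (\<lambda>y. \<gamma> y + t *\<^sub>R \<delta> y) x)) has_real_derivative 0) (at 0)}"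

definition shift_mat :: "'n::{finite,linorder} rmat" where
  "shift_mat = (\<chi> i j. if index_pos i = index_pos j + 1 then 1 else 0)"

definition central_affine_curvature ::
    "(real \<Rightarrow> 'n::{finite,linorder} rvec) \<Rightarrow> real \<Rightarrow> 'n rmat" where
  "central_affine_curvature \<gamma> x =
     (THE u. (\<exists>c :: 'n \<Rightarrow> real.
                u = (\<chi> i j. if index_pos i < CARD('n) - 1 \<and> index_pos j = CARD('n) - 1
                            then c i else 0)) \<and>
             matrix_inv (frame \<gamma> x) ** vderiv (frame \<gamma>) x = shift_mat + u)"

definition commutator :: "'n::finite rmat \<Rightarrow> 'n rmat \<Rightarrow> 'n rmat" where
  "commutator A B = A ** B - B ** A"

definition loop_pairing ::
    "(real \<Rightarrow> 'n::finite rmat) \<Rightarrow> (real \<Rightarrow> 'n rmat) \<Rightarrow> real" where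
  "loop_pairing \<xi> \<eta> = integral {0..2 * pi} (\<lambda>x. trace (\<xi> x ** \<eta> x))"

text \<open>\<open>[\<partial>\<^sub>x + A, B] = B\<^sub>x + [A, B]\<close>\<close>

definition conn_bracket ::
    "(real \<Rightarrow> 'n::finite rmat) \<Rightarrow> (real \<Rightarrow> 'n rmat) \<Rightarrow> real \<Rightarrow> 'n rmat" where
  "conn_bracket A B x = vderiv B x + commutator (A x) (B x)"

definition w2_hat ::
    "(real \<Rightarrow> 'n::{finite,linorder} rvec) \<Rightarrow> (real \<Rightarrow> 'n rvec) \<Rightarrow> (real \<Rightarrow> 'n rvec) \<Rightarrow> real" where
  "w2_hat \<gamma> \<delta>1 \<delta>2 =
     loop_pairing
       (conn_bracket (\<lambda>x. shift_mat + central_affine_curvature \<gamma> x)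
                     (\<lambda>x. matrix_inv (frame \<gamma> x) ** frame \<delta>1 x))
       (\<lambda>x. matrix_inv (frame \<gamma> x) ** frame \<delta>2 x)"

definition cocycle_rho ::
    "(real \<Rightarrow> 'n::finite rmat) \<Rightarrow> (real \<Rightarrow> 'n rmat) \<Rightarrow> real" where
  "cocycle_rho \<xi> \<eta> = integral {0..2 * pi} (\<lambda>x. trace (vderiv \<xi> x ** \<eta> x))"

text \<open>
  The gauge action preserves the coefficient 1 of \<open>\<partial>\<^sub>x\<close>, so that \<open>\<partial>\<^sub>x + v\<close> is represented by \<open>v\<close>;
  in particular \<open>\<partial>\<^sub>x\<close> is the zero function. A tangent vector has no \<open>\<partial>\<^sub>x\<close> component.
\<close>

definition gauge_act ::
    "(real \<Rightarrow> 'n::finite rmat) \<Rightarrow> (real \<Rightarrow> 'n rmat) \<Rightarrow> real \<Rightarrow> 'n rmat" where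
  "gauge_act h v x =
     h x ** v x ** matrix_inv (h x) - vderiv h x ** matrix_inv (h x)"

definition orbit_O2 :: "(real \<Rightarrow> 'n::finite rmat) set" where
  "orbit_O2 = {gauge_act h (\<lambda>x. 0) | h. h \<in> SL_loops}"

definition inf_field ::
    "(real \<Rightarrow> 'n::finite rmat) \<Rightarrow> (real \<Rightarrow> 'n rmat) \<Rightarrow> real \<Rightarrow> 'n rmat" where
  "inf_field \<xi> v x = - conn_bracket v \<xi> x"

definition orbit_tangents ::
    "(real \<Rightarrow> 'n::finite rmat) \<Rightarrow> (real \<Rightarrow> 'n rmat) set" where
  "orbit_tangents v = {inf_field \<xi> v | \<xi>. \<xi> \<in> sl_loops}"

text \<open>Orbit symplectic form: \<open>\<tau>\<^sub>\<ell>(\<xi>\<^sup>~(\<ell>), \<eta>\<^sup>~(\<ell>)) = \<ell>([\<xi>,\<eta>])\<close>, where the bracket of the central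
  extension contributes the cocycle term.\<close>

definition tau2 ::
    "(real \<Rightarrow> 'n::finite rmat) \<Rightarrow> (real \<Rightarrow> 'n rmat) \<Rightarrow> (real \<Rightarrow> 'n rmat) \<Rightarrow> real" where
  "tau2 v X Y =
     (THE r. \<exists>\<xi>\<in>sl_loops. \<exists>\<eta>\<in>sl_loops. X = inf_field \<xi> v \<and> Y = inf_field \<eta> v \<and>
        r = loop_pairing v (\<lambda>x. commutator (\<xi> x) (\<eta> x)) + cocycle_rho \<xi> \<eta>)"

definition k2 :: "(real \<Rightarrow> 'n::{finite,linorder} rvec) \<Rightarrow> real \<Rightarrow> 'n rmat" where
  "k2 \<gamma> x = matrix_inv (frame \<gamma> x) ** vderiv (frame \<gamma>) x"

text \<open>
  Differential of a map between function spaces, computed pointwise in \<open>x\<close>. For \<open>k2\<close> the segment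
  \<open>\<gamma> + t \<delta>\<gamma>\<close> leaves the set of curves with determinant 1, but the formula for \<open>k2\<close> is defined
  and smooth near \<open>t = 0\<close>, since the frame stays invertible at each \<open>x\<close>; on tangent vectors this
  derivative is the differential of the restricted map.
\<close>

definition func_differential ::
    "((real \<Rightarrow> 'a::real_vector) \<Rightarrow> real \<Rightarrow> 'b::real_normed_vector) \<Rightarrow>
     (real \<Rightarrow> 'a) \<Rightarrow> (real \<Rightarrow> 'a) \<Rightarrow> real \<Rightarrow> 'b" where
  "func_differential F \<gamma> \<delta> x = vector_derivative (\<lambda>t. F (\<lambda>y. \<gamma> y + t *\<^sub>R \<delta> y) x) (at 0)"

definition pullback2 ::
    "((real \<Rightarrow> 'a::real_vector) \<Rightarrow> real \<Rightarrow> 'b::real_normed_vector) \<Rightarrow>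
     ((real \<Rightarrow> 'b) \<Rightarrow> (real \<Rightarrow> 'b) \<Rightarrow> (real \<Rightarrow> 'b) \<Rightarrow> real) \<Rightarrow>
     (real \<Rightarrow> 'a) \<Rightarrow> (real \<Rightarrow> 'a) \<Rightarrow> (real \<Rightarrow> 'a) \<Rightarrow> real" where
  "pullback2 F \<omega> \<gamma> \<delta>1 \<delta>2 =
     \<omega> (F \<gamma>) (func_differential F \<gamma> \<delta>1) (func_differential F \<gamma> \<delta>2)"

end

theory Submission
  imports Defs
begin

text \<open>
  Put \<open>v = g\<^sup>-\<^sup>1 g\<^sub>x\<close> and \<open>A\<^sub>i = g\<^sup>-\<^sup>1 \<delta>\<^sub>i g\<close>. Then \<open>\<partial>\<^sub>x + v\<close> is the gauge transform of \<open>\<partial>\<^sub>x\<close> by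
  \<open>g\<^sup>-\<^sup>1\<close>, the linearized determinant condition says \<open>tr A\<^sub>i = 0\<close>, and differentiating \<open>g\<^sup>-\<^sup>1 g\<^sub>x\<close> along
  \<open>\<delta>\<^sub>i\<gamma>\<close> gives \<open>[\<partial>\<^sub>x + v, A\<^sub>i]\<close>, the infinitesimal vector field of \<open>-A\<^sub>i\<close>. Hence the pullback of \<open>\<tau>\<^sub>2\<close>
  is \<open>\<langle>[\<partial>\<^sub>x + v, -A\<^sub>1], -A\<^sub>2\<rangle> = \<langle>[\<partial>\<^sub>x + v, A\<^sub>1], A\<^sub>2\<rangle>\<close>; finally \<open>v = b + u\<close>, because \<open>g\<close> is built from
  successive derivatives and \<open>tr v = (ln det g)\<^sub>x = 0\<close>.
\<close>

section \<open>Matrix-valued functions of a real variable\<close>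

lemma bounded_bilinear_matrix_mult:
  "bounded_bilinear ((**) :: real^'n::finite^'n \<Rightarrow> real^'n^'n \<Rightarrow> real^'n^'n)"
  unfolding bilinear_conv_bounded_bilinear[symmetric] bilinear_def
  by (auto intro!: linearI simp: vec_eq_iff matrix_matrix_mult_def sum.distrib algebra_simps
      sum_distrib_left)

interpretation matmul: bounded_bilinear "(**) :: real^'n::finite^'n \<Rightarrow> real^'n^'n \<Rightarrow> real^'n^'n"
  by (rule bounded_bilinear_matrix_mult)

lemma linear_trace: "linear (trace :: real^'n::finite^'n \<Rightarrow> real)"
  by (auto intro!: linearI simp: trace_def sum.distrib sum_distrib_left)

lemma bounded_linear_trace: "bounded_linear (trace :: real^'n::finite^'n \<Rightarrow> real)"
  using linear_trace by (simp add: linear_conv_bounded_linear)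

lemma has_vector_derivative_matrix_iff:
  fixes F :: "real \<Rightarrow> real^'m::finite^'n::finite"
  shows "(F has_vector_derivative F') (at t) \<longleftrightarrow>
    (\<forall>i j. ((\<lambda>s. F s $ i $ j) has_real_derivative F' $ i $ j) (at t))"
  unfolding has_vector_derivative_def has_derivative_componentwise_within[of F]
  by (auto simp: Basis_vec_def inner_axis inner_axis' has_real_derivative_iff_has_vector_derivative
      has_vector_derivative_def)

lemma matrix_inv_right:
  fixes A :: "real^'n::finite^'n"
  assumes "det A \<noteq> 0"
  shows "A ** matrix_inv A = mat 1"
  using assms unfolding invertible_det_nz[symmetric] invertible_def matrix_inv_def
  by (metis (mono_tags, lifting) someI_ex)

lemma matrix_inv_left:
  fixes A :: "real^'n::finite^'n"
  assumes "det A \<noteq> 0"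
  shows "matrix_inv A ** A = mat 1"
  using matrix_inv_right[OF assms] by (simp add: matrix_left_right_inverse)

text \<open>Column \<open>j\<close> of the inverse solves the linear system with right-hand side the
  \<open>j\<close>-th unit vector, so Cramer's rule applies. The quotient of determinants is what
  makes the entries of the inverse visibly differentiable.\<close>

lemma matrix_inv_cramer:
  fixes A :: "real^'n::finite^'n"
  assumes "det A \<noteq> 0"
  shows "matrix_inv A $ i $ j = det (\<chi> k l. if l = i then mat 1 $ k $ j else A $ k $ l) / det A"
proof -
  have "A *v column j (matrix_inv A) = column j (mat 1)"
    unfolding matrix_inv_right[OF assms, symmetric]
    by (simp add: vec_eq_iff column_def matrix_vector_mult_def matrix_matrix_mult_def)
  then have "column j (matrix_inv A) $ i =
      det (\<chi> k l. if l = i then column j (mat 1) $ k else A $ k $ l) / det A"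
    unfolding cramer[OF assms] by simp
  then show ?thesis
    by (simp add: column_def cong: if_cong)
qed

section \<open>Derivatives of the determinant and of the inverse\<close>

lemma det_differentiable:
  fixes F :: "real \<Rightarrow> real^'n::finite^'n"
  assumes "\<And>i j. (\<lambda>s. F s $ i $ j) differentiable (at t)"
  shows "(\<lambda>s. det (F s)) differentiable (at t)"
proof -
  from assms obtain D where D: "\<And>i j. ((\<lambda>s. F s $ i $ j) has_real_derivative D i j) (at t)"
    unfolding real_differentiable_def by metis
  show ?thesis
    unfolding det_def real_differentiable_def
    by (rule exI, rule DERIV_sum, rule DERIV_cmult, rule has_field_derivative_prod, rule D)
qed

text \<open>Cramer's rule is used only for the existence of a derivative. Its value then follows by
  differentiating the identity \<open>F s ** matrix_inv (F s) = mat 1\<close> and solving for the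
  unknown factor.\<close>

lemma has_vector_derivative_matrix_inv:
  fixes F :: "real \<Rightarrow> real^'n::finite^'n"
  assumes F: "(F has_vector_derivative F') (at t)" and nz: "det (F t) \<noteq> 0"
  shows "((\<lambda>s. matrix_inv (F s)) has_vector_derivative
           - (matrix_inv (F t) ** F' ** matrix_inv (F t))) (at t)"
proof -
  define H where "H s = (\<chi> i j. det (\<chi> k l. if l = i then mat 1 $ k $ j else F s $ k $ l) / det (F s))"
    for s
  have entry: "(\<lambda>s. F s $ i $ j) differentiable (at t)" for i j
    using F unfolding has_vector_derivative_matrix_iff real_differentiable_def by blast
  have dF: "(\<lambda>s. det (F s)) differentiable (at t)"
    by (rule det_differentiable) (rule entry)
  have "(\<lambda>s. H s $ i $ j) differentiable (at t)" for i j
  proof -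
    have "(\<lambda>s. det (\<chi> k l. if l = i then mat 1 $ k $ j else F s $ k $ l)) differentiable (at t)"
    proof (rule det_differentiable)
      show "(\<lambda>s. (\<chi> k l. if l = i then mat 1 $ k $ j else F s $ k $ l) $ k $ l) differentiable (at t)"
        for k l
        by (cases "l = i") (simp_all add: entry)
    qed
    then show ?thesis
      unfolding H_def vec_lambda_beta by (rule differentiable_divide[OF _ dF nz])
  qed
  then obtain D where D: "\<And>i j. ((\<lambda>s. H s $ i $ j) has_real_derivative D i j) (at t)"
    unfolding real_differentiable_def by metis
  have H: "(H has_vector_derivative (\<chi> i j. D i j)) (at t)"
    using D by (simp add: has_vector_derivative_matrix_iff)
  \<comment> \<open>\<open>H\<close> is only known to agree with the inverse where the determinant
    is nonzero, so both transfers of derivatives below need an open neighbourhood of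
    \<open>t\<close> on which \<open>F s\<close> is invertible.\<close>
  have "isCont (\<lambda>s. det (F s)) t"
    using dF by (rule differentiable_imp_continuous_within)
  then have "\<forall>\<^sub>F s in at t. det (F s) \<noteq> 0"
    using nz unfolding isCont_def by (rule tendsto_imp_eventually_ne)
  then have "\<forall>\<^sub>F s in nhds t. det (F s) \<noteq> 0"
    using nz by (simp add: eventually_nhds_conv_at)
  then obtain S where S: "open S" "t \<in> S" "\<And>s. s \<in> S \<Longrightarrow> det (F s) \<noteq> 0"
    unfolding eventually_nhds by blast
  have inv: "((\<lambda>s. matrix_inv (F s)) has_vector_derivative (\<chi> i j. D i j)) (at t)"
    by (rule has_vector_derivative_transform_within_open[OF H S(1,2)])
      (simp only: H_def vec_eq_iff vec_lambda_beta matrix_inv_cramer[OF S(3)] simp_thms)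
  have "((\<lambda>s. F s ** matrix_inv (F s)) has_vector_derivative
      F t ** (\<chi> i j. D i j) + F' ** matrix_inv (F t)) (at t)"
    by (rule matmul.has_vector_derivative[OF F inv])
  moreover have "((\<lambda>s. F s ** matrix_inv (F s)) has_vector_derivative 0) (at t)"
    by (rule has_vector_derivative_transform_within_open[OF has_vector_derivative_const S(1,2)])
      (use S(3) in \<open>auto simp: matrix_inv_right\<close>)
  ultimately have "F t ** (\<chi> i j. D i j) + F' ** matrix_inv (F t) = 0"
    by (rule vector_derivative_unique_at)
  then have "F t ** (\<chi> i j. D i j) = - (F' ** matrix_inv (F t))"
    by (simp only: eq_neg_iff_add_eq_0)
  then have "matrix_inv (F t) ** (F t ** (\<chi> i j. D i j)) = - (matrix_inv (F t) ** F' ** matrix_inv (F t))"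
    by (simp add: matmul.minus_right matrix_mul_assoc)
  then show ?thesis
    using inv by (simp only: matrix_mul_assoc matrix_inv_left[OF nz] matrix_mul_lid)
qed

text \<open>A permutation other than the identity moves at least two indices, so that its term in the
  Leibniz expansion vanishes to second order at the identity matrix.\<close>

lemma has_real_derivative_det_at_one:
  fixes F :: "real \<Rightarrow> real^'n::finite^'n"
  assumes F: "(F has_vector_derivative F') (at t)" and one: "F t = mat 1"
  shows "((\<lambda>s. det (F s)) has_real_derivative trace F') (at t)"
proof -
  have D: "((\<lambda>s. F s $ i $ j) has_real_derivative F' $ i $ j) (at t)" for i j
    using F by (simp add: has_vector_derivative_matrix_iff)
  define T where "T p = (\<Sum>i\<in>UNIV. F' $ i $ p i * (\<Prod>j\<in>UNIV - {i}. F t $ j $ p j))" for p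
  have deriv: "((\<lambda>s. det (F s)) has_real_derivative
      (\<Sum>p | p permutes UNIV. of_int (sign p) * T p)) (at t)"
    unfolding det_def T_def
    by (rule DERIV_sum, rule DERIV_cmult, rule has_field_derivative_prod, rule D)
  have "T p = 0" if p: "p permutes UNIV" "p \<noteq> id" for p
  proof -
    obtain a where a: "p a \<noteq> a"
      using p(2) by (auto simp: fun_eq_iff)
    have "(\<Prod>j\<in>UNIV - {i}. F t $ j $ p j) = 0" for i
    proof -
      have "p (p a) \<noteq> p a"
        using a p(1) by (metis permutes_inj injD)
      then obtain b where "b \<noteq> i" "p b \<noteq> b"
        using a by metis
      then show ?thesis
        by (auto simp: one mat_def intro!: bexI[of _ b])
    qed
    then show ?thesis
      unfolding T_def by (simp only: mult_zero_right sum.neutral_const)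
  qed
  then have "(\<Sum>p | p permutes UNIV. of_int (sign p) * T p) =
      (\<Sum>p\<in>{id}. of_int (sign p) * T p)"
    by (intro sum.mono_neutral_right) (auto simp: permutes_id)
  also have "\<dots> = trace F'"
    by (simp add: T_def one mat_def trace_def)
  finally show ?thesis
    using deriv by simp
qed

text \<open>Jacobi's formula: left multiplication by the constant matrix
  \<open>matrix_inv (F t)\<close> moves the base point to the identity, and multiplicativity of the
  determinant restores the factor \<open>det (F t)\<close>.\<close>

lemma has_real_derivative_det:
  fixes F :: "real \<Rightarrow> real^'n::finite^'n"
  assumes F: "(F has_vector_derivative F') (at t)" and nz: "det (F t) \<noteq> 0"
  shows "((\<lambda>s. det (F s)) has_real_derivative det (F t) * trace (matrix_inv (F t) ** F')) (at t)"
proof -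
  have "((\<lambda>s. matrix_inv (F t) ** F s) has_vector_derivative matrix_inv (F t) ** F') (at t)"
    using matmul.has_vector_derivative[OF has_vector_derivative_const F] by simp
  then have "((\<lambda>s. det (matrix_inv (F t) ** F s)) has_real_derivative
      trace (matrix_inv (F t) ** F')) (at t)"
    by (rule has_real_derivative_det_at_one) (rule matrix_inv_left[OF nz])
  then have "((\<lambda>s. det (F t) * det (matrix_inv (F t) ** F s)) has_real_derivative
      det (F t) * trace (matrix_inv (F t) ** F')) (at t)"
    by (rule DERIV_cmult)
  moreover have "det (F t) * det (matrix_inv (F t) ** F s) = det (F s)" for s
    by (metis det_mul matrix_inv_right[OF nz] det_I mult.assoc mult_1)
  ultimately show ?thesis
    by simp
qed

section \<open>Smooth loops\<close>

text \<open>By induction every iterated derivative of \<open>f\<close> stays in \<open>S\<close>,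
  hence is differentiable. Periodicity is asked of \<open>f\<close> alone, as in the definition of
  \<open>smooth_loops\<close>.\<close>

lemma smooth_loops_coinduct:
  assumes "f \<in> S" "\<And>f. f \<in> S \<Longrightarrow> (\<forall>x. f differentiable (at x)) \<and> vderiv f \<in> S"
    and "\<And>x. f (x + 2 * pi) = f x"
  shows "f \<in> smooth_loops"
proof -
  have "(vderiv ^^ k) f \<in> S" for k
    by (induction k) (use assms(1,2) in auto)
  then show ?thesis
    using assms(2,3) by (auto simp: smooth_loops_def)
qed

lemma vderiv_eqI: "(f has_vector_derivative f') (at x) \<Longrightarrow> vderiv f x = f'"
  by (simp add: vderiv_def vector_derivative_at)

lemma smooth_loops_has_vderiv:
  "f \<in> smooth_loops \<Longrightarrow> (f has_vector_derivative vderiv f x) (at x)"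
  unfolding vderiv_def vector_derivative_works[symmetric] smooth_loops_def
  by (metis (mono_tags, lifting) funpow_0 mem_Collect_eq)

lemma smooth_loops_periodic: "f \<in> smooth_loops \<Longrightarrow> f (x + 2 * pi) = f x"
  by (simp add: smooth_loops_def)

lemma smooth_loops_vderiv:
  assumes f: "f \<in> smooth_loops"
  shows "vderiv f \<in> smooth_loops"
proof -
  have "(vderiv ^^ k) (vderiv f) differentiable (at x)" for k x
    using f unfolding smooth_loops_def funpow_swap1[symmetric]
    by (metis (mono_tags, lifting) mem_Collect_eq funpow.simps(2) o_apply)
  moreover have "vderiv f (x + 2 * pi) = vderiv f x" for x
  proof -
    have "(f \<circ> (\<lambda>y. y + 2 * pi) has_vector_derivative 1 *\<^sub>R vderiv f (x + 2 * pi)) (at x)"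
      by (rule vector_diff_chain_at)
        (auto intro!: derivative_eq_intros smooth_loops_has_vderiv f)
    then have "(f has_vector_derivative vderiv f (x + 2 * pi)) (at x)"
      by (simp add: o_def smooth_loops_periodic[OF f])
    then show ?thesis
      using vderiv_eqI by metis
  qed
  ultimately show ?thesis
    by (simp add: smooth_loops_def)
qed

lemma funpow_vderiv_smooth_loops: "f \<in> smooth_loops \<Longrightarrow> (vderiv ^^ k) f \<in> smooth_loops"
  by (induction k) (auto intro: smooth_loops_vderiv)

lemma smooth_loops_continuous_on: "f \<in> smooth_loops \<Longrightarrow> continuous_on A f"
  by (meson continuous_at_imp_continuous_on has_vector_derivative_continuous
      smooth_loops_has_vderiv)

text \<open>This set is closed under differentiation, so coinduction yields the smoothness of products and
  inverses at once, without Leibniz formulas for higher derivatives.\<close>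

inductive_set loop_algebra :: "(real \<Rightarrow> real^'n::finite^'n) set" where
  base: "f \<in> smooth_loops \<Longrightarrow> f \<in> loop_algebra"
| inv: "h \<in> SL_loops \<Longrightarrow> (\<lambda>x. matrix_inv (h x)) \<in> loop_algebra"
| uminus: "f \<in> loop_algebra \<Longrightarrow> (\<lambda>x. - f x) \<in> loop_algebra"
| add: "f \<in> loop_algebra \<Longrightarrow> f' \<in> loop_algebra \<Longrightarrow> (\<lambda>x. f x + f' x) \<in> loop_algebra"
| mult: "f \<in> loop_algebra \<Longrightarrow> f' \<in> loop_algebra \<Longrightarrow> (\<lambda>x. f x ** f' x) \<in> loop_algebra"

text \<open>The rules of the inductive set are chosen to match the derivative formulas: the product
  rule calls for sums, and the derivative of an inverse,
  \<open>- (matrix_inv h ** vderiv h ** matrix_inv h)\<close>, is again a word in the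
  generators.\<close>

lemma loop_algebra_has_vderiv:
  "f \<in> loop_algebra \<Longrightarrow>
    \<exists>f' \<in> loop_algebra. \<forall>x. (f has_vector_derivative f' x) (at x)"
proof (induction rule: loop_algebra.induct)
  case (base f)
  then show ?case
    by (blast intro: smooth_loops_vderiv smooth_loops_has_vderiv loop_algebra.base)
next
  case (inv h)
  then have h: "h \<in> smooth_loops" "\<And>x. det (h x) \<noteq> 0"
    by (auto simp: SL_loops_def)
  have "(\<lambda>x. - (matrix_inv (h x) ** vderiv h x ** matrix_inv (h x))) \<in> loop_algebra"
    by (intro loop_algebra.uminus loop_algebra.mult loop_algebra.inv loop_algebra.base
        smooth_loops_vderiv inv h)
  then show ?case
    by (rule bexI[rotated])
      (use has_vector_derivative_matrix_inv[OF smooth_loops_has_vderiv[OF h(1)] h(2)] in blast)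
next
  case (uminus f)
  then obtain f' where
    *: "f' \<in> loop_algebra" "\<And>x. (f has_vector_derivative f' x) (at x)"
    by blast
  show ?case
    by (rule bexI[OF _ loop_algebra.uminus[OF *(1)]])
      (intro allI has_vector_derivative_minus *)
next
  case (add f g)
  then obtain f' g' where
    *: "f' \<in> loop_algebra" "\<And>x. (f has_vector_derivative f' x) (at x)"
       "g' \<in> loop_algebra" "\<And>x. (g has_vector_derivative g' x) (at x)"
    by blast
  show ?case
    by (rule bexI[OF _ loop_algebra.add[OF *(1,3)]])
      (intro allI has_vector_derivative_add *)
next
  case (mult f g)
  then obtain f' g' where
    *: "f' \<in> loop_algebra" "\<And>x. (f has_vector_derivative f' x) (at x)"
       "g' \<in> loop_algebra" "\<And>x. (g has_vector_derivative g' x) (at x)"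
    by blast
  have "(\<lambda>x. f x ** g' x + f' x ** g x) \<in> loop_algebra"
    by (intro loop_algebra.add loop_algebra.mult * mult.hyps)
  then show ?case
    by (rule bexI[rotated]) (intro allI matmul.has_vector_derivative *)
qed

lemma loop_algebra_smooth: "loop_algebra \<subseteq> smooth_loops"
proof
  fix f :: "real \<Rightarrow> real^'n^'n"
  assume f: "f \<in> loop_algebra"
  show "f \<in> smooth_loops"
  proof (rule smooth_loops_coinduct[OF f])
    fix f :: "real \<Rightarrow> real^'n^'n"
    assume "f \<in> loop_algebra"
    then obtain f' where f': "f' \<in> loop_algebra" "\<And>x. (f has_vector_derivative f' x) (at x)"
      using loop_algebra_has_vderiv by blast
    then have "vderiv f = f'"
      by (auto simp: vderiv_eqI)
    with f' show "(\<forall>x. f differentiable (at x)) \<and> vderiv f \<in> loop_algebra"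
      by (auto intro: differentiableI_vector)
  next
    show "f (x + 2 * pi) = f x" for x
      using f by induction (auto simp: smooth_loops_periodic SL_loops_def)
  qed
qed

lemma smooth_loops_mult:
  fixes f f' :: "real \<Rightarrow> real^'n::finite^'n"
  shows "f \<in> smooth_loops \<Longrightarrow> f' \<in> smooth_loops \<Longrightarrow> (\<lambda>x. f x ** f' x) \<in> smooth_loops"
  using loop_algebra_smooth loop_algebra.mult loop_algebra.base by blast

lemma smooth_loops_uminus:
  fixes f :: "real \<Rightarrow> real^'n::finite^'n"
  shows "f \<in> smooth_loops \<Longrightarrow> (\<lambda>x. - f x) \<in> smooth_loops"
  using loop_algebra_smooth loop_algebra.uminus loop_algebra.base by blast

lemma smooth_loops_matrix_inv:
  "h \<in> SL_loops \<Longrightarrow> (\<lambda>x. matrix_inv (h x)) \<in> smooth_loops"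
  using loop_algebra_smooth loop_algebra.inv by blast

lemma SL_loops_matrix_inv:
  fixes h :: "real \<Rightarrow> real^'n::finite^'n"
  assumes "h \<in> SL_loops"
  shows "(\<lambda>x. matrix_inv (h x)) \<in> SL_loops"
proof -
  have "det (matrix_inv (h x)) = 1" for x
    using assms matrix_inv_right[of "h x"] det_mul[of "h x" "matrix_inv (h x)"]
    by (simp add: SL_loops_def)
  then show ?thesis
    using smooth_loops_matrix_inv[OF assms] by (simp add: SL_loops_def)
qed

lemma trace_log_derivative_SL:
  assumes "h \<in> SL_loops"
  shows "trace (matrix_inv (h x) ** vderiv h x) = 0"
proof -
  have "h \<in> smooth_loops" "det (h y) = 1" for y
    using assms by (auto simp: SL_loops_def)
  then have "((\<lambda>y. 1 :: real) has_real_derivative trace (matrix_inv (h x) ** vderiv h x)) (at x)"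
    using has_real_derivative_det[OF smooth_loops_has_vderiv, of h x] by simp
  then show ?thesis
    using DERIV_unique DERIV_const by blast
qed

section \<open>The orbit symplectic form\<close>

lemma conn_bracket_uminus:
  assumes "\<xi> \<in> smooth_loops"
  shows "conn_bracket v (\<lambda>x. - \<xi> x) x = - conn_bracket v \<xi> x"
  using vderiv_eqI[OF has_vector_derivative_minus[OF smooth_loops_has_vderiv[OF assms]]]
  by (simp add: conn_bracket_def commutator_def matmul.minus_left matmul.minus_right)

lemma conn_bracket_continuous_on:
  assumes "v \<in> smooth_loops" "\<xi> \<in> smooth_loops"
  shows "continuous_on A (conn_bracket v \<xi>)"
  unfolding conn_bracket_def[abs_def] commutator_def
  by (intro continuous_intros matmul.continuous_on smooth_loops_continuous_on
      smooth_loops_vderiv assms)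

lemma trace_mult_integrable:
  fixes f f' :: "real \<Rightarrow> real^'n::finite^'n"
  assumes "continuous_on {a..b} f" "continuous_on {a..b} f'"
  shows "(\<lambda>x. trace (f x ** f' x)) integrable_on {a..b}"
  by (intro integrable_continuous_interval
      bounded_linear.continuous_on[OF bounded_linear_trace] matmul.continuous_on assms)

text \<open>Ad-invariance of the trace form, a consequence of cyclicity of the trace.\<close>

lemma trace_commutator:
  fixes A B C :: "real^'n::finite^'n"
  shows "trace (A ** commutator B C) = trace (commutator A B ** C)"
  using trace_mul_sym[of "A ** C" B]
  by (simp add: commutator_def matmul.diff_left matmul.diff_right trace_sub matrix_mul_assoc)

text \<open>Ad-invariance turns the integrand of the first term into the trace of
  \<open>commutator v \<xi> ** \<eta>\<close>, and the cocycle supplies the missing derivative of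
  \<xi>. No integration by parts is involved.\<close>

lemma pairing_commutator_add_cocycle:
  assumes "v \<in> smooth_loops" "\<xi> \<in> smooth_loops" "\<eta> \<in> smooth_loops"
  shows "loop_pairing v (\<lambda>x. commutator (\<xi> x) (\<eta> x)) + cocycle_rho \<xi> \<eta> =
    loop_pairing (conn_bracket v \<xi>) \<eta>"
proof -
  have "loop_pairing v (\<lambda>x. commutator (\<xi> x) (\<eta> x)) + cocycle_rho \<xi> \<eta> =
      integral {0..2 * pi} (\<lambda>x. trace (v x ** commutator (\<xi> x) (\<eta> x)) + trace (vderiv \<xi> x ** \<eta> x))"
    unfolding loop_pairing_def cocycle_rho_def
    unfolding commutator_def
    by (intro integral_add[symmetric] trace_mult_integrable continuous_intros
        matmul.continuous_on smooth_loops_continuous_on smooth_loops_vderiv assms)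
  also have "\<dots> = loop_pairing (conn_bracket v \<xi>) \<eta>"
    unfolding loop_pairing_def conn_bracket_def
    by (simp add: trace_commutator matmul.add_left trace_add add.commute)
  finally show ?thesis .
qed

text \<open>In the sum of the two integrands the commutator parts cancel by ad-invariance, leaving
  the derivative of the trace of \<open>\<xi> ** \<eta>\<close>. Its integral over a full period
  vanishes.\<close>

lemma pairing_conn_bracket_skew:
  assumes v: "v \<in> smooth_loops" and \<xi>: "\<xi> \<in> smooth_loops" and \<eta>: "\<eta> \<in> smooth_loops"
  shows "loop_pairing (conn_bracket v \<xi>) \<eta> = - loop_pairing \<xi> (conn_bracket v \<eta>)"
proof -
  have eq: "trace (conn_bracket v \<xi> x ** \<eta> x) + trace (\<xi> x ** conn_bracket v \<eta> x) =
      trace (\<xi> x ** vderiv \<eta> x + vderiv \<xi> x ** \<eta> x)" for x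
    using trace_commutator[of "\<xi> x" "v x" "\<eta> x"]
    by (simp add: conn_bracket_def matmul.add_left matmul.add_right trace_add)
       (simp add: commutator_def matmul.diff_left matmul.diff_right trace_sub)
  have "((\<lambda>x. trace (\<xi> x ** \<eta> x)) has_vector_derivative
      trace (\<xi> x ** vderiv \<eta> x + vderiv \<xi> x ** \<eta> x)) (at x)" for x
    by (intro bounded_linear.has_vector_derivative[OF bounded_linear_trace]
        matmul.has_vector_derivative smooth_loops_has_vderiv \<xi> \<eta>)
  then have "((\<lambda>x. trace (\<xi> x ** vderiv \<eta> x + vderiv \<xi> x ** \<eta> x)) has_integral
      trace (\<xi> (2 * pi) ** \<eta> (2 * pi)) - trace (\<xi> 0 ** \<eta> 0)) {0..2 * pi}"
    by (intro fundamental_theorem_of_calculus) (auto intro: has_vector_derivative_at_within)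
  then have "integral {0..2 * pi}
      (\<lambda>x. trace (conn_bracket v \<xi> x ** \<eta> x) + trace (\<xi> x ** conn_bracket v \<eta> x)) = 0"
    using smooth_loops_periodic[OF \<xi>, of 0] smooth_loops_periodic[OF \<eta>, of 0]
    by (simp add: eq integral_unique)
  moreover have "integral {0..2 * pi}
      (\<lambda>x. trace (conn_bracket v \<xi> x ** \<eta> x) + trace (\<xi> x ** conn_bracket v \<eta> x)) =
      loop_pairing (conn_bracket v \<xi>) \<eta> + loop_pairing \<xi> (conn_bracket v \<eta>)"
    unfolding loop_pairing_def
    by (intro integral_add trace_mult_integrable conn_bracket_continuous_on
        smooth_loops_continuous_on v \<xi> \<eta>)
  ultimately show ?thesis
    by simp
qed

text \<open>By skew-symmetry the value depends only on the two tangent vectors, and not on the loops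
  generating them, so that the definite description in the definition of the form is meaningful.\<close>

lemma tau2_inf_field:
  assumes v: "v \<in> smooth_loops" and \<xi>: "\<xi> \<in> sl_loops" and \<eta>: "\<eta> \<in> sl_loops"
  shows "tau2 v (inf_field \<xi> v) (inf_field \<eta> v) = loop_pairing (conn_bracket v \<xi>) \<eta>"
  unfolding tau2_def
proof (rule the_equality)
  show "\<exists>\<xi>'\<in>sl_loops. \<exists>\<eta>'\<in>sl_loops. inf_field \<xi> v = inf_field \<xi>' v \<and>
      inf_field \<eta> v = inf_field \<eta>' v \<and>
      loop_pairing (conn_bracket v \<xi>) \<eta> =
        loop_pairing v (\<lambda>x. commutator (\<xi>' x) (\<eta>' x)) + cocycle_rho \<xi>' \<eta>'"
    using pairing_commutator_add_cocycle[OF v, of \<xi> \<eta>] \<xi> \<eta>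
    by (intro bexI[of _ \<xi>] bexI[of _ \<eta>]) (auto simp: sl_loops_def)
next
  fix r
  assume "\<exists>\<xi>'\<in>sl_loops. \<exists>\<eta>'\<in>sl_loops. inf_field \<xi> v = inf_field \<xi>' v \<and>
      inf_field \<eta> v = inf_field \<eta>' v \<and>
      r = loop_pairing v (\<lambda>x. commutator (\<xi>' x) (\<eta>' x)) + cocycle_rho \<xi>' \<eta>'"
  then obtain \<xi>' \<eta>' where *: "\<xi>' \<in> sl_loops" "\<eta>' \<in> sl_loops"
      "inf_field \<xi> v = inf_field \<xi>' v" "inf_field \<eta> v = inf_field \<eta>' v"
      "r = loop_pairing v (\<lambda>x. commutator (\<xi>' x) (\<eta>' x)) + cocycle_rho \<xi>' \<eta>'"
    by blast
  have s: "\<xi> \<in> smooth_loops" "\<eta> \<in> smooth_loops" "\<xi>' \<in> smooth_loops" "\<eta>' \<in> smooth_loops"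
    using \<xi> \<eta> * by (auto simp: sl_loops_def)
  have eq: "conn_bracket v \<xi> = conn_bracket v \<xi>'" "conn_bracket v \<eta> = conn_bracket v \<eta>'"
    using *(3,4) by (auto simp: inf_field_def fun_eq_iff)
  have "r = loop_pairing (conn_bracket v \<xi>') \<eta>'"
    using * pairing_commutator_add_cocycle[OF v s(3,4)] by simp
  \<comment> \<open>The generators are exchanged one at a time: once the bracket sits on
    \<open>\<eta>'\<close> it depends only on the tangent vector, so \<open>\<eta>'\<close> becomes
    \<eta>. Moving the bracket back does the same for \<open>\<xi>'\<close>.\<close>
  also have "\<dots> = - loop_pairing \<xi>' (conn_bracket v \<eta>)"
    using pairing_conn_bracket_skew[OF v s(3,4)] eq by simp
  also have "\<dots> = loop_pairing (conn_bracket v \<xi>) \<eta>"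
    using pairing_conn_bracket_skew[OF v s(3,2)] eq by simp
  finally show "r = loop_pairing (conn_bracket v \<xi>) \<eta>" .
qed

section \<open>The central affine moving frame\<close>

lemma index_pos_less: "index_pos (i :: 'n::{finite,linorder}) < CARD('n)"
  unfolding index_pos_def by (rule psubset_card_mono) auto

lemma inj_index_pos: "inj (index_pos :: 'n::{finite,linorder} \<Rightarrow> nat)"
proof -
  have "index_pos i < index_pos j" if "i < j" for i j :: 'n
    unfolding index_pos_def by (rule psubset_card_mono) (use that in auto)
  then show ?thesis
    by (metis injI linorder_neqE less_irrefl)
qed

lemma range_index_pos: "range (index_pos :: 'n::{finite,linorder} \<Rightarrow> nat) = {..<CARD('n)}"
  using card_image[OF inj_index_pos] index_pos_less by (intro card_subset_eq) auto

text \<open>Differentiating the frame shifts every column to the next derivative of the curve. This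
  gives both the smoothness of the frame and the subdiagonal ones of \<open>k2\<close>.\<close>

lemma frame_has_vderiv:
  assumes "\<gamma> \<in> smooth_loops"
  shows "(frame \<gamma> has_vector_derivative frame (vderiv \<gamma>) x) (at x)"
proof -
  have "((\<lambda>y. (vderiv ^^ k) \<gamma> y $ i) has_real_derivative (vderiv ^^ k) (vderiv \<gamma>) x $ i) (at x)"
    for k i
    unfolding has_real_derivative_iff_has_vector_derivative funpow_swap1[symmetric]
    by (intro bounded_linear.has_vector_derivative[OF bounded_linear_vec_nth]
        smooth_loops_has_vderiv funpow_vderiv_smooth_loops assms)
  then show ?thesis
    by (simp add: has_vector_derivative_matrix_iff frame_def)
qed

lemma smooth_loops_frame:
  fixes \<gamma> :: "real \<Rightarrow> 'n::{finite,linorder} rvec"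
  assumes "\<gamma> \<in> smooth_loops"
  shows "frame \<gamma> \<in> smooth_loops"
proof (rule smooth_loops_coinduct[where S = "frame ` smooth_loops"])
  show "(\<forall>x. f differentiable (at x)) \<and> vderiv f \<in> frame ` smooth_loops"
    if f: "f \<in> frame ` smooth_loops" for f :: "real \<Rightarrow> 'n rmat"
  proof -
    obtain \<beta> where \<beta>: "\<beta> \<in> smooth_loops" "f = frame \<beta>"
      using f by blast
    then have "vderiv f = frame (vderiv \<beta>)"
      by (auto simp: vderiv_eqI[OF frame_has_vderiv])
    with \<beta> show ?thesis
      by (auto intro: smooth_loops_vderiv differentiableI_vector[OF frame_has_vderiv])
  qed
  show "frame \<gamma> (x + 2 * pi) = frame \<gamma> x" for x
    by (simp add: frame_def smooth_loops_periodic[OF funpow_vderiv_smooth_loops[OF assms]])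
qed (use assms in blast)

text \<open>Iterated derivatives are linear, so the frame is affine along a segment of curves.
  Derivatives along \<delta> thereby become derivatives of affine matrix paths.\<close>

lemma frame_add_scaleR:
  assumes \<gamma>: "\<gamma> \<in> smooth_loops" and \<delta>: "\<delta> \<in> smooth_loops"
  shows "frame (\<lambda>y. \<gamma> y + t *\<^sub>R \<delta> y) x = frame \<gamma> x + t *\<^sub>R frame \<delta> x"
proof -
  have "(vderiv ^^ k) (\<lambda>y. \<gamma> y + t *\<^sub>R \<delta> y) =
      (\<lambda>y. (vderiv ^^ k) \<gamma> y + t *\<^sub>R (vderiv ^^ k) \<delta> y)" for k
  proof (induction k)
    case (Suc k)
    have "((\<lambda>y. (vderiv ^^ k) \<gamma> y + t *\<^sub>R (vderiv ^^ k) \<delta> y) has_vector_derivative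
        vderiv ((vderiv ^^ k) \<gamma>) y + t *\<^sub>R vderiv ((vderiv ^^ k) \<delta>) y) (at y)" for y
      by (intro has_vector_derivative_add smooth_loops_has_vderiv funpow_vderiv_smooth_loops \<gamma> \<delta>
          bounded_linear.has_vector_derivative[OF bounded_linear_scaleR_right])
    then show ?case
      by (auto simp: Suc.IH vderiv_eqI)
  qed simp
  then show ?thesis
    by (simp add: frame_def vec_eq_iff)
qed

section \<open>The image of \<open>k2\<close>: gauge orbit and normal form\<close>

lemma SL_loops_frame: "\<gamma> \<in> central_affine_curves \<Longrightarrow> frame \<gamma> \<in> SL_loops"
  by (simp add: central_affine_curves_def SL_loops_def smooth_loops_frame)

lemma smooth_loops_k2:
  assumes "\<gamma> \<in> central_affine_curves"
  shows "k2 \<gamma> \<in> smooth_loops"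
  unfolding k2_def[abs_def] using SL_loops_frame[OF assms]
  by (auto intro!: smooth_loops_mult smooth_loops_matrix_inv smooth_loops_vderiv
      simp: SL_loops_def)

lemma k2_in_orbit_O2:
  assumes "\<gamma> \<in> central_affine_curves"
  shows "k2 \<gamma> \<in> orbit_O2"
proof -
  let ?h = "\<lambda>x. matrix_inv (frame \<gamma> x)"
  have g: "frame \<gamma> \<in> smooth_loops" and d: "det (frame \<gamma> x) \<noteq> 0" for x
    using SL_loops_frame[OF assms] by (auto simp: SL_loops_def)
  have h: "?h \<in> SL_loops"
    using SL_loops_matrix_inv[OF SL_loops_frame[OF assms]] .
  have "k2 \<gamma> x = gauge_act ?h (\<lambda>x. 0) x" for x
  proof -
    have "vderiv ?h x = - (?h x ** vderiv (frame \<gamma>) x ** ?h x)"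
      by (rule vderiv_eqI[OF has_vector_derivative_matrix_inv[OF smooth_loops_has_vderiv[OF g] d]])
    \<comment> \<open>The inverse of \<open>?h x\<close> need not be identified with the frame:
      substituting the derivative of \<open>?h\<close> into the gauge action leaves it next to
      \<open>?h x\<close>, where it cancels.\<close>
    moreover have "?h x ** matrix_inv (?h x) = mat 1"
      using h by (intro matrix_inv_right) (simp add: SL_loops_def)
    ultimately show ?thesis
      by (simp add: k2_def gauge_act_def matmul.minus_left matmul.zero_left matmul.zero_right
          flip: matrix_mul_assoc)
  qed
  then show ?thesis
    using h unfolding orbit_O2_def by blast
qed

text \<open>All columns but the last are fixed by the shift of derivatives, and vanishing of the
  trace fixes the bottom entry of the last one. The remaining entries are the curvature.\<close>

lemma k2_eq_shift_add_curvature: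
  fixes \<gamma> :: "real \<Rightarrow> 'n::{finite,linorder} rvec"
  assumes "\<gamma> \<in> central_affine_curves"
  shows "k2 \<gamma> x = shift_mat + central_affine_curvature \<gamma> x"
proof -
  let ?g = "frame \<gamma> x" and ?last = "CARD('n) - 1"
  have \<gamma>: "\<gamma> \<in> smooth_loops" and d: "det ?g \<noteq> 0"
    using assms by (auto simp: central_affine_curves_def)
  have vd: "vderiv (frame \<gamma>) x = frame (vderiv \<gamma>) x"
    by (rule vderiv_eqI[OF frame_has_vderiv[OF \<gamma>]])
  have col: "k2 \<gamma> x $ i $ j = shift_mat $ i $ j" if j: "index_pos j \<noteq> ?last" for i j
  proof -
    \<comment> \<open>As \<open>j\<close> is not the last index, column \<open>j\<close> of the
      differentiated frame is a column of the frame itself, which the inverse frame sends to a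
      column of the identity.\<close>
    have "index_pos j + 1 \<in> range (index_pos :: 'n \<Rightarrow> nat)"
      unfolding range_index_pos using j index_pos_less[of j] by simp
    then obtain j' :: 'n where j': "index_pos j' = index_pos j + 1"
      by auto
    have "vderiv (frame \<gamma>) x $ k $ j = ?g $ k $ j'" for k
      unfolding vd by (simp add: frame_def j' funpow_swap1)
    then have "k2 \<gamma> x $ i $ j = (matrix_inv ?g ** ?g) $ i $ j'"
      by (simp add: k2_def matrix_matrix_mult_def)
    also have "\<dots> = shift_mat $ i $ j"
      using inj_eq[OF inj_index_pos, of i j']
      by (auto simp: matrix_inv_left[OF d] mat_def shift_mat_def j')
    finally show ?thesis .
  qed
  have "k2 \<gamma> x $ l $ l = 0" if l: "index_pos l = ?last" for l
  proof -
    \<comment> \<open>The other diagonal entries agree with those of \<open>shift_mat\<close>, which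
      are zero, so the bottom right entry is the whole trace.\<close>
    have "trace (k2 \<gamma> x) = (\<Sum>i\<in>{l}. k2 \<gamma> x $ i $ i)"
      unfolding trace_def
    proof (rule sum.mono_neutral_right)
      show "\<forall>i\<in>UNIV - {l}. k2 \<gamma> x $ i $ i = 0"
        using l inj_eq[OF inj_index_pos, of _ l] by (auto simp: col shift_mat_def)
    qed auto
    then show ?thesis
      using trace_log_derivative_SL[OF SL_loops_frame[OF assms], of x] by (simp add: k2_def)
  qed
  then have last: "k2 \<gamma> x $ i $ j = shift_mat $ i $ j"
    if "\<not> index_pos i < ?last" "index_pos j = ?last" for i j
    using that index_pos_less[of i] inj_eq[OF inj_index_pos, of i j]
    by (auto simp: shift_mat_def)
  let ?P = "\<lambda>u. (\<exists>c :: 'n \<Rightarrow> real.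
                u = (\<chi> i j. if index_pos i < ?last \<and> index_pos j = ?last then c i else 0)) \<and>
             matrix_inv ?g ** vderiv (frame \<gamma>) x = shift_mat + u"
  obtain l :: 'n where l: "index_pos l = ?last"
    using range_index_pos[where 'n='n]
    by (metis (no_types, lifting) imageE lessThan_iff zero_less_card_finite diff_less zero_less_one)
  have "k2 \<gamma> x - shift_mat =
      (\<chi> i j. if index_pos i < ?last \<and> index_pos j = ?last
              then (k2 \<gamma> x - shift_mat) $ i $ l else 0)"
  proof -
    have "(k2 \<gamma> x - shift_mat) $ i $ j =
        (if index_pos i < ?last \<and> index_pos j = ?last
         then (k2 \<gamma> x - shift_mat) $ i $ l else 0)" for i j
    proof (cases "index_pos j = ?last")
      case True
      then have "j = l"
        using l by (metis injD inj_index_pos)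
      then show ?thesis
        using last[of i l] l by simp
    qed (simp add: col)
    then show ?thesis
      by (simp add: vec_eq_iff)
  qed
  then have "?P (k2 \<gamma> x - shift_mat)"
    by (intro conjI exI[of _ "\<lambda>i. (k2 \<gamma> x - shift_mat) $ i $ l"])
      (assumption, simp only: k2_def add_diff_cancel_left' diff_add_cancel add.commute[of shift_mat])
  then have "central_affine_curvature \<gamma> x = k2 \<gamma> x - shift_mat"
    \<comment> \<open>Uniqueness is immediate, since the second conjunct already determines
      \<open>u\<close>.\<close>
    unfolding central_affine_curvature_def by (rule the_equality) (auto simp: k2_def)
  then show ?thesis
    by simp
qed

section \<open>Variations of the frame and the pullback\<close>

lemma sl_loops_curve_tangent:
  assumes \<gamma>: "\<gamma> \<in> central_affine_curves" and \<delta>: "\<delta> \<in> curve_tangents \<gamma>"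
  shows "(\<lambda>x. - (matrix_inv (frame \<gamma> x) ** frame \<delta> x)) \<in> sl_loops"
proof -
  have s: "\<gamma> \<in> smooth_loops" "\<delta> \<in> smooth_loops" and d: "det (frame \<gamma> x) = 1" for x
    using \<gamma> \<delta> by (auto simp: central_affine_curves_def curve_tangents_def)
  \<comment> \<open>The linearized determinant condition is computed a second time by Jacobi's
    formula, where the frame has determinant 1; uniqueness of derivatives equates the two
    values.\<close>
  have "trace (matrix_inv (frame \<gamma> x) ** frame \<delta> x) = 0" for x
  proof -
    have "((\<lambda>t. frame \<gamma> x + t *\<^sub>R frame \<delta> x) has_vector_derivative frame \<delta> x) (at 0)"
      by (auto intro!: derivative_eq_intros)
    from has_real_derivative_det[OF this]
    have "((\<lambda>t. det (frame \<gamma> x + t *\<^sub>R frame \<delta> x)) has_real_derivative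
        trace (matrix_inv (frame \<gamma> x) ** frame \<delta> x)) (at 0)"
      by (simp add: d)
    moreover have "((\<lambda>t. det (frame \<gamma> x + t *\<^sub>R frame \<delta> x)) has_real_derivative 0) (at 0)"
      using \<delta> by (simp add: curve_tangents_def frame_add_scaleR[OF s])
    ultimately show ?thesis
      by (rule DERIV_unique)
  qed
  moreover have "(\<lambda>x. matrix_inv (frame \<gamma> x) ** frame \<delta> x) \<in> smooth_loops"
    by (intro smooth_loops_mult smooth_loops_matrix_inv SL_loops_frame \<gamma> smooth_loops_frame s)
  ultimately show ?thesis
    by (simp add: sl_loops_def smooth_loops_uminus linear_neg[OF linear_trace])
qed

text \<open>Write \<open>g\<close>, \<open>e\<close> for the frames of \<gamma>, \<delta> and
  \<open>A\<close> for the inverse of \<open>g\<close> times \<open>e\<close>. Both sides reduce to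
  \<open>g^-1 e_x - A v\<close> with \<open>v = k2 \<gamma>\<close>: on the right, the term
  \<open>- v A\<close> in the derivative of \<open>A\<close> cancels against the commutator. The
  generator is \<open>- A\<close> because \<open>inf_field\<close> carries a minus sign.\<close>

lemma func_differential_k2:
  fixes \<gamma> \<delta> :: "real \<Rightarrow> 'n::{finite,linorder} rvec"
  assumes \<gamma>: "\<gamma> \<in> central_affine_curves" and \<delta>: "\<delta> \<in> smooth_loops"
  shows "func_differential k2 \<gamma> \<delta> =
    inf_field (\<lambda>x. - (matrix_inv (frame \<gamma> x) ** frame \<delta> x)) (k2 \<gamma>)"
proof
  fix x
  let ?g = "frame \<gamma>" and ?e = "frame \<delta>" and ?h = "\<lambda>x. matrix_inv (frame \<gamma> x)"
  have s: "\<gamma> \<in> smooth_loops" and d: "det (?g x) \<noteq> 0" for x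
    using \<gamma> by (auto simp: central_affine_curves_def)
  note D = smooth_loops_has_vderiv[OF smooth_loops_frame[OF s]]
    smooth_loops_has_vderiv[OF smooth_loops_frame[OF \<delta>]]
  have "k2 (\<lambda>y. \<gamma> y + t *\<^sub>R \<delta> y) x =
      matrix_inv (?g x + t *\<^sub>R ?e x) ** (vderiv ?g x + t *\<^sub>R vderiv ?e x)" for t
  proof -
    have "frame (\<lambda>y. \<gamma> y + t *\<^sub>R \<delta> y) = (\<lambda>x. ?g x + t *\<^sub>R ?e x)"
      by (auto simp: frame_add_scaleR[OF s \<delta>])
    moreover have "((\<lambda>x. ?g x + t *\<^sub>R ?e x) has_vector_derivative
        vderiv ?g x + t *\<^sub>R vderiv ?e x) (at x)"
      by (intro has_vector_derivative_add D
          bounded_linear.has_vector_derivative[OF bounded_linear_scaleR_right])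
    ultimately show ?thesis
      by (simp add: k2_def vderiv_eqI)
  qed
  moreover have "((\<lambda>t. matrix_inv (?g x + t *\<^sub>R ?e x) ** (vderiv ?g x + t *\<^sub>R vderiv ?e x))
      has_vector_derivative
        ?h x ** vderiv ?e x + - (?h x ** ?e x ** ?h x) ** vderiv ?g x) (at 0)"
  proof -
    \<comment> \<open>This is used twice: for the frame under the inverse and for its derivative in
      \<open>x\<close>, both affine in \<open>t\<close>.\<close>
    have "((\<lambda>t. A + t *\<^sub>R B) has_vector_derivative B) (at 0)" for A B :: "'n rmat"
      by (auto intro!: derivative_eq_intros)
    from matmul.has_vector_derivative[OF has_vector_derivative_matrix_inv[OF this] this]
    show ?thesis
      using d[of x] by simp
  qed
  ultimately have "func_differential k2 \<gamma> \<delta> x =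
      ?h x ** vderiv ?e x - ?h x ** ?e x ** ?h x ** vderiv ?g x"
    by (simp add: func_differential_def vector_derivative_at matmul.minus_left)
  moreover have "vderiv (\<lambda>x. ?h x ** ?e x) x =
      ?h x ** vderiv ?e x + - (?h x ** vderiv ?g x ** ?h x) ** ?e x"
    by (intro vderiv_eqI matmul.has_vector_derivative has_vector_derivative_matrix_inv D d)
  moreover have "(\<lambda>x. ?h x ** ?e x) \<in> smooth_loops"
    by (intro smooth_loops_mult smooth_loops_matrix_inv SL_loops_frame \<gamma> smooth_loops_frame \<delta>)
  ultimately show "func_differential k2 \<gamma> \<delta> x =
      inf_field (\<lambda>x. - (?h x ** ?e x)) (k2 \<gamma>) x"
    by (simp add: inf_field_def conn_bracket_uminus)
      (simp add: conn_bracket_def commutator_def k2_def matmul.minus_left matrix_mul_assoc)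
qed

lemma pullback2_k2_tau2:
  assumes \<gamma>: "\<gamma> \<in> central_affine_curves"
    and \<delta>1: "\<delta>1 \<in> curve_tangents \<gamma>" and \<delta>2: "\<delta>2 \<in> curve_tangents \<gamma>"
  shows "pullback2 k2 tau2 \<gamma> \<delta>1 \<delta>2 = w2_hat \<gamma> \<delta>1 \<delta>2"
proof -
  let ?A = "\<lambda>\<delta> x. matrix_inv (frame \<gamma> x) ** frame \<delta> x"
  have s: "\<delta>1 \<in> smooth_loops" "\<delta>2 \<in> smooth_loops"
    using \<delta>1 \<delta>2 by (auto simp: curve_tangents_def)
  have "?A \<delta>1 \<in> smooth_loops"
    by (intro smooth_loops_mult smooth_loops_matrix_inv SL_loops_frame \<gamma> smooth_loops_frame s)
  then have neg: "conn_bracket (k2 \<gamma>) (\<lambda>x. - ?A \<delta>1 x) x = - conn_bracket (k2 \<gamma>) (?A \<delta>1) x" for x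
    by (rule conn_bracket_uminus)
  have "pullback2 k2 tau2 \<gamma> \<delta>1 \<delta>2 =
      loop_pairing (conn_bracket (k2 \<gamma>) (\<lambda>x. - ?A \<delta>1 x)) (\<lambda>x. - ?A \<delta>2 x)"
    unfolding pullback2_def func_differential_k2[OF \<gamma> s(1)] func_differential_k2[OF \<gamma> s(2)]
    by (intro tau2_inf_field smooth_loops_k2 sl_loops_curve_tangent \<gamma> \<delta>1 \<delta>2)
  also have "\<dots> = loop_pairing (conn_bracket (k2 \<gamma>) (?A \<delta>1)) (?A \<delta>2)"
    by (simp add: loop_pairing_def neg matmul.minus_left matmul.minus_right)
  also have "k2 \<gamma> = (\<lambda>x. shift_mat + central_affine_curvature \<gamma> x)"
    using k2_eq_shift_add_curvature[OF \<gamma>] by blast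
  finally show ?thesis
    by (simp add: w2_hat_def)
qed

theorem theorem6p11:
  assumes "CARD('n::{finite,linorder}) \<ge> 2"
  shows "\<forall>\<gamma> \<in> (central_affine_curves :: (real \<Rightarrow> 'n rvec) set).
           k2 \<gamma> \<in> orbit_O2 \<and>
           (\<forall>\<delta> \<in> curve_tangents \<gamma>. func_differential k2 \<gamma> \<delta> \<in> orbit_tangents (k2 \<gamma>)) \<and>
           (\<forall>\<delta>1 \<in> curve_tangents \<gamma>. \<forall>\<delta>2 \<in> curve_tangents \<gamma>.
              pullback2 k2 tau2 \<gamma> \<delta>1 \<delta>2 = w2_hat \<gamma> \<delta>1 \<delta>2)"
proof (intro ballI conjI)
  fix \<gamma> :: "real \<Rightarrow> 'n rvec"
  assume \<gamma>: "\<gamma> \<in> central_affine_curves"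
  show "k2 \<gamma> \<in> orbit_O2"
    by (rule k2_in_orbit_O2[OF \<gamma>])
  show "func_differential k2 \<gamma> \<delta> \<in> orbit_tangents (k2 \<gamma>)" if "\<delta> \<in> curve_tangents \<gamma>" for \<delta>
    using func_differential_k2[OF \<gamma>, of \<delta>] sl_loops_curve_tangent[OF \<gamma> that] that
    unfolding orbit_tangents_def curve_tangents_def by blast
  show "pullback2 k2 tau2 \<gamma> \<delta>1 \<delta>2 = w2_hat \<gamma> \<delta>1 \<delta>2"
    if "\<delta>1 \<in> curve_tangents \<gamma>" "\<delta>2 \<in> curve_tangents \<gamma>" for \<delta>1 \<delta>2
    by (rule pullback2_k2_tau2[OF \<gamma> that])
qed

end
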